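(* Let $\theta^{(1)},\theta^{(-1)}\in\{-1,1\}^d$ and $0<t\le 1/2$, and let $D=\mathrm{Bernoulli}(\theta^{(1)},\theta^{(-1)},t)$ be the uniform mixture of two multivariate Bernoulli distributions on $\{-1,1\}^d\times\{-1,1\}$. Let $\epsilon>0$ and consider $\ell_\infty$ perturbations of size at most $\epsilon$. Then: 1. If $\epsilon<1$, the classifier $h^{\star(adv)}:\mathbb{R}^d\to\{-1,1\}$ given by $$h^{\star(adv)}(x)=\begin{cases}1, & \|T(x)-\theta^{(1)}\|_0\le\|T(x)-\theta^{(-1)}\|_0,\\ -1, & \text{otherwise},\end{cases}$$ where $T(x)=(\mathrm{sign}(x_1),\dots,\mathrm{sign}(x_d))$, with $\mathrm{sign}(r)=1$ if $r\ge0$ and $\mathrm{sign}(r)=-1$ otherwise, is an $(\infty,\epsilon)$-optimal robust classifier on $D$. 2. The $(\infty,\epsilon)$-optimal classification error rate on $D$ equals $R(h^\star,D)$ if $\epsilon<1$ and equals $1/2$ if $\epsilon\ge1$, where $h^\star$ is the optimal Bayes classifier on $D$.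
   Context: Under $\mathrm{Bernoulli}(\theta^{(1)},\theta^{(-1)},t)$, the label $y$ is uniform on $\{-1,1\}$ and, given $y$, the coordinates $x_1,\dots,x_d$ are independent with $x_i=\theta_i^{(y)}$ with probability $1/2+t$ and $x_i=-\theta_i^{(y)}$ with probability $1/2-t$. $\|v\|_0$ is the number of nonzero coordinates of $v$. Classifiers are functions $h:\mathbb{R}^d\to\{-1,1\}$. The error rate is $R(h,D)=\mathbb{E}_{(x,y)\sim D}\{\mathbb{I}(h(x)\ne y)\}$, and an optimal Bayes classifier is one minimizing it. The adversarial error rate is $$R^{(adv)}_{\infty,\epsilon}(h,D)=\mathbb{E}_{(x,y)\sim D}\left\{\mathbb{I}\left(\exists\delta\in\mathbb{R}^d,\ \|\delta\|_\infty\le\epsilon : h(x+\delta)\ne y\right)\right\}.$$ A classifier is $(\infty,\epsilon)$-optimal robust on $D$ if it minimizes $R^{(adv)}_{\infty,\epsilon}(\cdot,D)$ among classifiers, and the minimal value is the $(\infty,\epsilon)$-optimal classification error rate. *)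

theory Defs
  imports "HOL-Probability.Probability" "HOL-Probability.Product_PMF"
begin

definition classifier :: "(real ^ 'd \<Rightarrow> int) \<Rightarrow> bool" where
  "classifier h \<longleftrightarrow> (\<forall>x. h x \<in> {-1, 1})"

definition coord_pmf :: "real \<Rightarrow> real \<Rightarrow> real pmf" where
  "coord_pmf a t = map_pmf (\<lambda>b. if b then a else - a) (bernoulli_pmf (1/2 + t))"

(* Pi_pmf UNIV makes the coordinates independent. Its default value 0 is only used outside
   the index set, hence never. *)
definition bernoulli_mixture ::
    "real ^ 'd::finite \<Rightarrow> real ^ 'd \<Rightarrow> real \<Rightarrow> ((real ^ 'd) \<times> int) pmf" where
  "bernoulli_mixture \<theta>pos \<theta>neg t =
     bind_pmf (pmf_of_set {-1, 1}) (\<lambda>y.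
       map_pmf (\<lambda>x. (\<chi> i. x i, y))
         (Pi_pmf UNIV 0 (\<lambda>i. coord_pmf ((if y = 1 then \<theta>pos else \<theta>neg) $ i) t)))"

definition error_rate :: "(real ^ 'd \<Rightarrow> int) \<Rightarrow> ((real ^ 'd::finite) \<times> int) pmf \<Rightarrow> real" where
  "error_rate h D = measure_pmf.expectation D (\<lambda>(x, y). of_bool (h x \<noteq> y))"

definition adv_error_rate ::
    "real \<Rightarrow> (real ^ 'd \<Rightarrow> int) \<Rightarrow> ((real ^ 'd::finite) \<times> int) pmf \<Rightarrow> real" where
  "adv_error_rate \<epsilon> h D =
     measure_pmf.expectation D (\<lambda>(x, y). of_bool (\<exists>\<delta>. infnorm \<delta> \<le> \<epsilon> \<and> h (x + \<delta>) \<noteq> y))"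

definition bayes_optimal :: "((real ^ 'd::finite) \<times> int) pmf \<Rightarrow> (real ^ 'd \<Rightarrow> int) \<Rightarrow> bool" where
  "bayes_optimal D h \<longleftrightarrow>
     classifier h \<and> (\<forall>h'. classifier h' \<longrightarrow> error_rate h D \<le> error_rate h' D)"

definition optimal_robust ::
    "real \<Rightarrow> ((real ^ 'd::finite) \<times> int) pmf \<Rightarrow> (real ^ 'd \<Rightarrow> int) \<Rightarrow> bool" where
  "optimal_robust \<epsilon> D h \<longleftrightarrow>
     classifier h \<and> (\<forall>h'. classifier h' \<longrightarrow> adv_error_rate \<epsilon> h D \<le> adv_error_rate \<epsilon> h' D)"

(* A predicate rather than an infimum, so that it asserts that the minimum is attained. *)
definition is_optimal_robust_rate ::
    "real \<Rightarrow> ((real ^ 'd::finite) \<times> int) pmf \<Rightarrow> real \<Rightarrow> bool" where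
  "is_optimal_robust_rate \<epsilon> D r \<longleftrightarrow> (\<exists>h. optimal_robust \<epsilon> D h \<and> adv_error_rate \<epsilon> h D = r)"

definition norm0 :: "real ^ 'd::finite \<Rightarrow> nat" where
  "norm0 v = card {i. v $ i \<noteq> 0}"

(* Unlike sgn, this sends 0 to 1. *)
definition sign1 :: "real \<Rightarrow> real" where
  "sign1 r = (if r \<ge> 0 then 1 else - 1)"

definition sign_vec :: "real ^ 'd \<Rightarrow> real ^ 'd" where
  "sign_vec x = (\<chi> i. sign1 (x $ i))"

definition h_adv :: "real ^ 'd::finite \<Rightarrow> real ^ 'd \<Rightarrow> real ^ 'd \<Rightarrow> int" where
  "h_adv \<theta>pos \<theta>neg x =
     (if norm0 (sign_vec x - \<theta>pos) \<le> norm0 (sign_vec x - \<theta>neg) then 1 else - 1)"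

end

theory Submission imports Defs begin

text \<open>
  On the cube, the likelihood of \<open>x\<close> under a class depends only on the number of coordinates in
  which \<open>x\<close> differs from the class centre and decreases in it, so the nearest-centre rule
  minimises the error at every point. For \<open>\<epsilon> < 1\<close> a perturbation cannot change the
  sign vector of a cube point, so this rule has adversarial error equal to its Bayes error, while the
  adversarial error of any classifier is at least its ordinary error. For \<open>\<epsilon> \<ge> 1\<close>
  every cube point can be moved to the origin, so the class on which a classifier errs at the origin
  is lost entirely.
\<close>

section \<open>The two class distributions on the sign cube\<close>

definition cube :: "(real ^ 'd) set" where
  "cube = {x. \<forall>i. x $ i \<in> {-1, 1}}"

text \<open>The conditional law of the point given its label, split off from the label so that its
  mass function can be compared between the two classes.\<close>

definition class_pmf :: "real ^ 'd::finite \<Rightarrow> real \<Rightarrow> (real ^ 'd) pmf" where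
  "class_pmf \<theta> t = map_pmf vec_lambda (Pi_pmf UNIV 0 (\<lambda>i. coord_pmf (\<theta> $ i) t))"

lemma finite_cube: "finite (cube :: (real ^ 'd::finite) set)"
proof -
  have "cube \<subseteq> vec_lambda ` (UNIV \<rightarrow>\<^sub>E {-1, 1 :: real} :: ('d \<Rightarrow> real) set)"
  proof
    fix x :: "real ^ 'd" assume "x \<in> cube"
    then have "($) x \<in> UNIV \<rightarrow>\<^sub>E {-1, 1}" by (auto simp: cube_def)
    then show "x \<in> vec_lambda ` (UNIV \<rightarrow>\<^sub>E {-1, 1})"
      by (metis image_eqI vec_nth_inverse)
  qed
  then show ?thesis
    by (rule finite_subset) (intro finite_imageI finite_PiE, auto)
qed

lemma bernoulli_mixture_altdef:
  "bernoulli_mixture \<theta>pos \<theta>neg t =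
     bind_pmf (pmf_of_set {-1, 1})
       (\<lambda>y. map_pmf (\<lambda>x. (x, y)) (class_pmf (if y = 1 then \<theta>pos else \<theta>neg) t))"
  by (simp add: bernoulli_mixture_def class_pmf_def map_pmf_comp)

lemma set_coord_pmf: "a \<in> {-1, 1} \<Longrightarrow> set_pmf (coord_pmf a t) \<subseteq> {-1, 1}"
  by (auto simp: coord_pmf_def)

lemma set_class_pmf:
  fixes \<theta> :: "real ^ 'd::finite"
  assumes "\<theta> \<in> cube"
  shows "set_pmf (class_pmf \<theta> t) \<subseteq> cube"
proof -
  have "x i \<in> {-1, 1}" if "x \<in> set_pmf (Pi_pmf UNIV 0 (\<lambda>i. coord_pmf (\<theta> $ i) t))" for x i
    using that set_coord_pmf[of "\<theta> $ i" t] assms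
    by (auto simp: set_Pi_pmf PiE_dflt_def cube_def)
  then show ?thesis by (fastforce simp: class_pmf_def cube_def)
qed

text \<open>Since \<open>a\<close> is nonzero, \<open>a\<close> and \<open>- a\<close> are distinct,
  so each value comes from exactly one Bernoulli outcome. The bounds on \<open>t\<close> make
  \<open>1/2 + t\<close> a genuine probability.\<close>

lemma pmf_coord_pmf:
  assumes "a \<in> {-1, 1}" "v \<in> {-1, 1}" "0 < t" "t \<le> 1/2"
  shows "pmf (coord_pmf a t) v = (if v \<noteq> a then 1/2 - t else 1/2 + t)"
proof -
  have inj: "inj (\<lambda>b. if b then a else - a)" using assms(1) by (auto simp: inj_on_def)
  let ?f = "\<lambda>b. if b then a else - a"
  have "pmf (coord_pmf a t) (?f (v = a)) = pmf (bernoulli_pmf (1/2 + t)) (v = a)"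
    unfolding coord_pmf_def using inj by (rule pmf_map_inj')
  moreover have "?f (v = a) = v" using assms(1,2) by auto
  ultimately show ?thesis using assms(3,4) by auto
qed

lemma pmf_class_pmf:
  fixes \<theta> x :: "real ^ 'd::finite"
  assumes "\<theta> \<in> cube" "x \<in> cube" "0 < t" "t \<le> 1/2"
  shows "pmf (class_pmf \<theta> t) x =
    (1/2 - t) ^ norm0 (x - \<theta>) * (1/2 + t) ^ (CARD('d) - norm0 (x - \<theta>))"
proof -
  let ?S = "{i. x $ i \<noteq> \<theta> $ i}"
  have "inj (vec_lambda :: ('d \<Rightarrow> real) \<Rightarrow> _)"
    by (metis injI vec_lambda_inverse UNIV_I)
  \<comment> \<open>The vector is written as the image of its coordinate function, so that
    injectivity of \<open>vec_lambda\<close> carries the mass over from the product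
    distribution.\<close>
  then have "pmf (class_pmf \<theta> t) (vec_lambda (($) x)) =
      pmf (Pi_pmf UNIV 0 (\<lambda>i. coord_pmf (\<theta> $ i) t)) (($) x)"
    unfolding class_pmf_def by (rule pmf_map_inj')
  then have "pmf (class_pmf \<theta> t) x = (\<Prod>i\<in>UNIV. pmf (coord_pmf (\<theta> $ i) t) (x $ i))"
    by (simp add: pmf_Pi vec_nth_inverse)
  also have "\<dots> = (\<Prod>i\<in>UNIV. if x $ i \<noteq> \<theta> $ i then 1/2 - t else 1/2 + t)"
    using assms by (intro prod.cong refl pmf_coord_pmf) (auto simp: cube_def)
  also have "\<dots> = (1/2 - t) ^ card ?S * (1/2 + t) ^ card (- ?S)"
    by (subst prod.If_cases) simp_all
  also have "card (- ?S) = CARD('d) - card ?S"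
    by (subst Compl_eq_Diff_UNIV, rule card_Diff_subset) auto
  finally show ?thesis by (simp add: norm0_def)
qed

lemma norm0_le_card: "norm0 (v :: real ^ 'd::finite) \<le> CARD('d)"
  unfolding norm0_def by (rule card_mono) auto

text \<open>Each additional mismatch replaces a factor \<open>1/2 + t\<close> of the likelihood by
  the smaller factor \<open>1/2 - t\<close>.\<close>

lemma pmf_class_pmf_antimono:
  fixes \<theta> \<theta>' x :: "real ^ 'd::finite"
  assumes "\<theta> \<in> cube" "\<theta>' \<in> cube" "x \<in> cube" "0 < t" "t \<le> 1/2"
    and le: "norm0 (x - \<theta>) \<le> norm0 (x - \<theta>')"
  shows "pmf (class_pmf \<theta>' t) x \<le> pmf (class_pmf \<theta> t) x"
proof -
  let ?p = "1/2 + t" and ?q = "1/2 - t" and ?n = "CARD('d)"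
  define j k where "j = norm0 (x - \<theta>)" and "k = norm0 (x - \<theta>')"
  have jk: "j \<le> k" "k \<le> ?n"
    using le norm0_le_card unfolding j_def k_def by blast+
  \<comment> \<open>Isolate the \<open>k - j\<close> excess mismatches: only their factors differ
    between the two likelihoods.\<close>
  have "?q ^ k * ?p ^ (?n - k) = ?q ^ j * ?q ^ (k - j) * ?p ^ (?n - k)"
    using jk by (simp flip: power_add)
  also have "\<dots> \<le> ?q ^ j * ?p ^ (k - j) * ?p ^ (?n - k)"
    using assms(4,5) by (intro mult_mono mult_left_mono power_mono) auto
  also have "\<dots> = ?q ^ j * ?p ^ (?n - j)"
    using jk by (simp add: mult.assoc flip: power_add)
  finally show ?thesis
    using assms(1-5) by (simp add: pmf_class_pmf j_def k_def)
qed

section \<open>Expectations under the mixture, and its support\<close>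

text \<open>This allows classifiers to be compared point by point on the cube. The division by 2 is
  the uniform weight of the two labels.\<close>

lemma expectation_bernoulli_mixture:
  fixes f :: "(real ^ 'd::finite) \<times> int \<Rightarrow> real"
  assumes "\<theta>pos \<in> cube" "\<theta>neg \<in> cube"
  shows "measure_pmf.expectation (bernoulli_mixture \<theta>pos \<theta>neg t) f =
    (\<Sum>x\<in>cube. pmf (class_pmf \<theta>pos t) x * f (x, 1) + pmf (class_pmf \<theta>neg t) x * f (x, -1)) / 2"
proof -
  have fin: "finite (set_pmf (class_pmf \<theta> t))" if "\<theta> \<in> cube" for \<theta> :: "real ^ 'd"
    using set_class_pmf[OF that] finite_cube by (rule finite_subset)
  have exp: "measure_pmf.expectation (class_pmf \<theta> t) g = (\<Sum>x\<in>cube. pmf (class_pmf \<theta> t) x * g x)"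
    if "\<theta> \<in> cube" for \<theta> and g :: "real ^ 'd \<Rightarrow> real"
    using set_class_pmf[OF that]
    by (subst integral_measure_pmf[OF finite_cube]) auto
  show ?thesis
    unfolding bernoulli_mixture_altdef
    by (subst pmf_expectation_bind_pmf_of_set)
      (auto simp: fin assms exp sum.distrib)
qed

text \<open>The zero perturbation is always admissible. Finite support provides
  integrability.\<close>

lemma error_rate_le_adv_error_rate:
  fixes D :: "((real ^ 'd::finite) \<times> int) pmf"
  assumes "finite (set_pmf D)" "0 \<le> \<epsilon>"
  shows "error_rate h D \<le> adv_error_rate \<epsilon> h D"
  unfolding error_rate_def adv_error_rate_def
proof (rule integral_mono)
  fix z :: "(real ^ 'd) \<times> int"
  show "(case z of (x, y) \<Rightarrow> of_bool (h x \<noteq> y))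
     \<le> ((case z of (x, y) \<Rightarrow> of_bool (\<exists>\<delta>. infnorm \<delta> \<le> \<epsilon> \<and> h (x + \<delta>) \<noteq> y)) :: real)"
    using assms(2) by (auto simp: split_beta infnorm_0 intro!: exI[of _ 0])
qed (auto intro!: integrable_measure_pmf_finite assms)

lemma set_bernoulli_mixture:
  assumes "\<theta>pos \<in> cube" "\<theta>neg \<in> cube"
  shows "set_pmf (bernoulli_mixture \<theta>pos \<theta>neg t) \<subseteq> cube \<times> {-1, 1}"
  using set_class_pmf[OF assms(1)] set_class_pmf[OF assms(2)]
  unfolding bernoulli_mixture_altdef by (auto split: if_splits)

lemma finite_set_bernoulli_mixture:
  assumes "\<theta>pos \<in> cube" "\<theta>neg \<in> cube"
  shows "finite (set_pmf (bernoulli_mixture \<theta>pos \<theta>neg t))"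
  using set_bernoulli_mixture[OF assms] by (rule finite_subset) (simp add: finite_cube)

section \<open>Perturbations of cube points\<close>

text \<open>A coordinate at distance 1 from zero cannot reach zero by a move of size less than 1.
  The bound must be strict: a move of size 1 takes -1 to 0, where \<open>sign1\<close> is 1.\<close>

lemma sign_vec_cube_add:
  fixes x \<delta> :: "real ^ 'd::finite"
  assumes "x \<in> cube" "infnorm \<delta> < 1"
  shows "sign_vec (x + \<delta>) = x"
proof -
  have "\<bar>\<delta> $ i\<bar> < 1" for i
    using component_le_infnorm_cart[of \<delta> i] assms(2) by linarith
  moreover have "x $ i = -1 \<or> x $ i = 1" for i
    using assms(1) by (auto simp: cube_def)
  ultimately have "sign1 (x $ i + \<delta> $ i) = x $ i" for i
    by (smt (verit) sign1_def)
  then show ?thesis by (simp add: sign_vec_def vec_eq_iff)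
qed

lemma sign_vec_cube: "x \<in> cube \<Longrightarrow> sign_vec x = (x :: real ^ 'd::finite)"
  using sign_vec_cube_add[of x 0] by (simp add: infnorm_0)

text \<open>Hence \<open>- x\<close> is an admissible perturbation of \<open>x\<close> once
  \<epsilon> \<ge> 1, and it leads to the origin.\<close>

lemma infnorm_cube_le:
  assumes "x \<in> cube"
  shows "infnorm (x :: real ^ 'd::finite) \<le> 1"
proof -
  have "x $ i = -1 \<or> x $ i = 1" for i
    using assms by (auto simp: cube_def)
  then have "\<bar>x $ i\<bar> \<le> 1" for i by (metis abs_1 abs_minus_cancel order_refl)
  then show ?thesis
    unfolding infnorm_cart by (intro cSup_least) auto
qed

lemma classifier_h_adv: "classifier (h_adv \<theta>pos \<theta>neg)"
  by (simp add: classifier_def h_adv_def)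

lemma adv_error_rate_h_adv:
  assumes "\<theta>pos \<in> cube" "\<theta>neg \<in> cube" "0 \<le> \<epsilon>" "\<epsilon> < 1"
  shows "adv_error_rate \<epsilon> (h_adv \<theta>pos \<theta>neg) (bernoulli_mixture \<theta>pos \<theta>neg t)
    = error_rate (h_adv \<theta>pos \<theta>neg) (bernoulli_mixture \<theta>pos \<theta>neg t)"
  unfolding adv_error_rate_def error_rate_def
\<comment> \<open>The integrands are compared on the support only: away from the cube, a small
  perturbation may well flip signs.\<close>
proof (intro integral_cong_AE AE_pmfI)
  fix z assume "z \<in> set_pmf (bernoulli_mixture \<theta>pos \<theta>neg t)"
  then have x: "fst z \<in> cube" using set_bernoulli_mixture[OF assms(1,2)] by fastforce
  have "h_adv \<theta>pos \<theta>neg (fst z + \<delta>) = h_adv \<theta>pos \<theta>neg (fst z)" if "infnorm \<delta> \<le> \<epsilon>" for \<delta>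
    using that assms(4) x by (simp add: h_adv_def sign_vec_cube_add sign_vec_cube)
  moreover have "infnorm (0 :: real ^ 'a) \<le> \<epsilon>" using assms(3) by (simp add: infnorm_0)
  ultimately have "(\<exists>\<delta>. infnorm \<delta> \<le> \<epsilon> \<and> h_adv \<theta>pos \<theta>neg (fst z + \<delta>) \<noteq> snd z)
      \<longleftrightarrow> h_adv \<theta>pos \<theta>neg (fst z) \<noteq> snd z" by metis
  then show "((case z of (x, y) \<Rightarrow>
        of_bool (\<exists>\<delta>. infnorm \<delta> \<le> \<epsilon> \<and> h_adv \<theta>pos \<theta>neg (x + \<delta>) \<noteq> y)) :: real)
      = (case z of (x, y) \<Rightarrow> of_bool (h_adv \<theta>pos \<theta>neg x \<noteq> y))"
    by (simp add: split_beta)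
qed auto

section \<open>Bayes optimality of the nearest-centre rule\<close>

lemma bayes_optimal_h_adv:
  fixes \<theta>pos \<theta>neg :: "real ^ 'd::finite"
  assumes c: "\<theta>pos \<in> cube" "\<theta>neg \<in> cube" and t: "0 < t" "t \<le> 1/2"
  shows "bayes_optimal (bernoulli_mixture \<theta>pos \<theta>neg t) (h_adv \<theta>pos \<theta>neg)"
proof -
  let ?p = "\<lambda>\<theta>. pmf (class_pmf \<theta> t)"
  have "error_rate (h_adv \<theta>pos \<theta>neg) (bernoulli_mixture \<theta>pos \<theta>neg t)
      \<le> error_rate h (bernoulli_mixture \<theta>pos \<theta>neg t)" if "classifier h" for h
    unfolding error_rate_def expectation_bernoulli_mixture[OF c]
  \<comment> \<open>At each cube point a classifier pays the mass of the class it rejects. The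
    nearest-centre rule rejects a class of smaller or equal mass, so it wins summand by
    summand.\<close>
  proof (intro divide_right_mono sum_mono)
    fix x :: "real ^ 'd" assume x: "x \<in> cube"
    have "h x = 1 \<or> h x = -1" using that by (auto simp: classifier_def)
    moreover have "?p \<theta>neg x \<le> ?p \<theta>pos x" if "h_adv \<theta>pos \<theta>neg x = 1"
      using pmf_class_pmf_antimono[OF c x t] that
      by (simp add: h_adv_def sign_vec_cube[OF x] split: if_splits)
    moreover have "?p \<theta>pos x \<le> ?p \<theta>neg x" if "h_adv \<theta>pos \<theta>neg x = -1"
      using pmf_class_pmf_antimono[OF c(2,1) x t] that
      by (simp add: h_adv_def sign_vec_cube[OF x] split: if_splits)
    moreover have "h_adv \<theta>pos \<theta>neg x = 1 \<or> h_adv \<theta>pos \<theta>neg x = -1"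
      by (simp add: h_adv_def)
    ultimately show "?p \<theta>pos x * (case (x, 1) of (x, y) \<Rightarrow> of_bool (h_adv \<theta>pos \<theta>neg x \<noteq> y))
        + ?p \<theta>neg x * (case (x, -1) of (x, y) \<Rightarrow> of_bool (h_adv \<theta>pos \<theta>neg x \<noteq> y))
      \<le> ?p \<theta>pos x * (case (x, 1) of (x, y) \<Rightarrow> of_bool (h x \<noteq> y))
        + ?p \<theta>neg x * (case (x, -1) of (x, y) \<Rightarrow> of_bool (h x \<noteq> y))"
      by (elim disjE) simp_all
  qed simp
  then show ?thesis by (simp add: bayes_optimal_def classifier_h_adv)
qed

section \<open>Constant classifiers and perturbations of size at least 1\<close>

text \<open>A constant errs on the whole of one class and nowhere on the other, and each class has
  weight 1/2.\<close>

lemma error_rate_const: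
  fixes \<theta>pos \<theta>neg :: "real ^ 'd::finite"
  assumes "\<theta>pos \<in> cube" "\<theta>neg \<in> cube" "c \<in> {-1, 1}"
  shows "error_rate (\<lambda>_. c) (bernoulli_mixture \<theta>pos \<theta>neg t) = 1/2"
proof -
  have "(\<Sum>x\<in>cube. pmf (class_pmf \<theta> t) x) = 1" if "\<theta> \<in> cube" for \<theta> :: "real ^ 'd"
    using sum_pmf_eq_1[OF finite_cube set_class_pmf[OF that]] .
  then show ?thesis
    unfolding error_rate_def expectation_bernoulli_mixture[OF assms(1,2)]
    using assms by auto
qed

text \<open>Perturbations cannot change a constant answer. Nonnegativity of \<epsilon> only ensures
  that some perturbation is admissible, since otherwise the adversarial event would be
  empty.\<close>

lemma adv_error_rate_const:
  assumes "0 \<le> \<epsilon>"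
  shows "adv_error_rate \<epsilon> (\<lambda>_. c) D = error_rate (\<lambda>_. c) (D :: ((real ^ 'd::finite) \<times> int) pmf)"
proof -
  have "\<exists>\<delta> :: real ^ 'd. infnorm \<delta> \<le> \<epsilon>"
    using assms by (intro exI[of _ 0]) (simp add: infnorm_0)
  then show ?thesis by (simp add: adv_error_rate_def error_rate_def)
qed

text \<open>The adversary can force the answer \<open>h 0\<close> on every cube point, so
  \<open>h\<close> does no better against it than the constant classifier with that value.\<close>

lemma adv_error_rate_ge_half:
  fixes \<theta>pos \<theta>neg :: "real ^ 'd::finite"
  assumes c: "\<theta>pos \<in> cube" "\<theta>neg \<in> cube" and "1 \<le> \<epsilon>" "classifier h"
  shows "1/2 \<le> adv_error_rate \<epsilon> h (bernoulli_mixture \<theta>pos \<theta>neg t)" (is "_ \<le> adv_error_rate \<epsilon> h ?D")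
proof -
  have "h 0 \<in> {-1, 1}" using assms(4) by (simp add: classifier_def)
  then have "1/2 = error_rate (\<lambda>_. h 0) ?D"
    using error_rate_const[OF c] by simp
  also have "\<dots> \<le> adv_error_rate \<epsilon> h ?D"
    unfolding error_rate_def adv_error_rate_def
  proof (intro integral_mono_AE AE_pmfI integrable_measure_pmf_finite finite_set_bernoulli_mixture c)
    fix z assume "z \<in> set_pmf ?D"
    then have "fst z \<in> cube" using set_bernoulli_mixture[OF c] by fastforce
    then have "infnorm (- fst z) \<le> \<epsilon>"
      using infnorm_cube_le assms(3) by (fastforce simp: infnorm_neg)
    then show "(case z of (x, y) \<Rightarrow> of_bool (h 0 \<noteq> y))
      \<le> ((case z of (x, y) \<Rightarrow> of_bool (\<exists>\<delta>. infnorm \<delta> \<le> \<epsilon> \<and> h (x + \<delta>) \<noteq> y)) :: real)"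
      by (auto simp: split_beta intro!: exI[of _ "- fst z"])
  qed
  finally show ?thesis .
qed

theorem theorem5:
  fixes \<theta>pos \<theta>neg :: "real ^ 'd::finite" and t \<epsilon> :: real
    and D :: "((real ^ 'd) \<times> int) pmf"
  assumes "\<And>i. \<theta>pos $ i \<in> {-1, 1}"
    and "\<And>i. \<theta>neg $ i \<in> {-1, 1}"
    and "0 < t" and "t \<le> 1/2"
    and "D = bernoulli_mixture \<theta>pos \<theta>neg t"
    and "\<epsilon> > 0"
  shows "(\<epsilon> < 1 \<longrightarrow> optimal_robust \<epsilon> D (h_adv \<theta>pos \<theta>neg))
    \<and> (\<exists>hstar. bayes_optimal D hstar)
    \<and> (\<forall>hstar. bayes_optimal D hstar \<longrightarrow>
         (\<epsilon> < 1 \<longrightarrow> is_optimal_robust_rate \<epsilon> D (error_rate hstar D)))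
    \<and> (\<epsilon> \<ge> 1 \<longrightarrow> is_optimal_robust_rate \<epsilon> D (1/2))"
proof -
  have c: "\<theta>pos \<in> cube" "\<theta>neg \<in> cube"
    using assms(1,2) by (auto simp: cube_def)
  note D = assms(5)
  have bayes: "bayes_optimal D (h_adv \<theta>pos \<theta>neg)"
    using bayes_optimal_h_adv[OF c assms(3,4)] D by simp
  have robust: "optimal_robust \<epsilon> D (h_adv \<theta>pos \<theta>neg)"
    and adv: "adv_error_rate \<epsilon> (h_adv \<theta>pos \<theta>neg) D = error_rate (h_adv \<theta>pos \<theta>neg) D"
    if "\<epsilon> < 1"
  proof -
    show adv: "adv_error_rate \<epsilon> (h_adv \<theta>pos \<theta>neg) D = error_rate (h_adv \<theta>pos \<theta>neg) D"
      using adv_error_rate_h_adv[OF c] that assms(6) D by simp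
    have "error_rate h D \<le> adv_error_rate \<epsilon> h D" for h
      using error_rate_le_adv_error_rate[of D \<epsilon>] finite_set_bernoulli_mixture[OF c] assms(6) D
      by simp
    then show "optimal_robust \<epsilon> D (h_adv \<theta>pos \<theta>neg)"
      \<comment> \<open>For any competitor \<open>h\<close>, the adversarial error of the rule
        equals its ordinary error, which is at most the ordinary error of \<open>h\<close> and hence
        at most the adversarial error of \<open>h\<close>.\<close>
      using bayes unfolding optimal_robust_def bayes_optimal_def adv by (meson order_trans)
  qed
  have "is_optimal_robust_rate \<epsilon> D (error_rate hstar D)" if "bayes_optimal D hstar" "\<epsilon> < 1" for hstar
  proof -
    \<comment> \<open>Bayes optimal classifiers may differ, but each is at most as bad as the other,
      so they share one error rate. The minimiser of the adversarial error remains the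
      nearest-centre rule, not \<open>hstar\<close>.\<close>
    have "error_rate (h_adv \<theta>pos \<theta>neg) D = error_rate hstar D"
      using bayes that(1) by (meson bayes_optimal_def order_antisym)
    then show ?thesis
      using robust adv that(2) by (auto simp: is_optimal_robust_rate_def)
  qed
  moreover have "is_optimal_robust_rate \<epsilon> D (1/2)" if "1 \<le> \<epsilon>"
  proof -
    \<comment> \<open>The constant 1 serves as witness that the lower bound 1/2 is attained.\<close>
    have const: "adv_error_rate \<epsilon> (\<lambda>_. 1) D = 1/2"
      using adv_error_rate_const[of \<epsilon> 1 D] error_rate_const[OF c, of 1] assms(6) D by simp
    have "optimal_robust \<epsilon> D (\<lambda>_. 1)"
      unfolding optimal_robust_def const
      using adv_error_rate_ge_half[OF c that] D by (auto simp: classifier_def)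
    then show ?thesis using const by (auto simp: is_optimal_robust_rate_def)
  qed
  ultimately show ?thesis using bayes robust by blast
qed

end
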